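(* Let $E$ be a Banach space and let $\mathcal{F}$ be a commuting family of affine nonexpansive mappings from $E$ to itself. Suppose $X$ is a nonempty convex subset of $E$ such that for all $T\in\mathcal{F}$ we have $TX\subset X$ and $m(T,X)=0$, where $m(T,X)=\inf\{\|x-Tx\| : x\in X\}$. Then there exists a metric functional $\mathbf{h}\in X^{\diamondsuit}$ such that $\mathbf{h}(Tx)\le \mathbf{h}(x)$ for all $x\in E$ and for all $T\in\mathcal{F}$.
   Context: Banach spaces are real. A mapping $T:E\to E$ is nonexpansive if $\|Tx-Ty\|\le\|x-y\|$ for all $x,y\in E$. The family $\mathcal{F}$ is commuting if $TU=UT$ for all $T,U\in\mathcal{F}$. Metric functionals: fix a base point $o\in E$. For $w\in E$ define $\mathbf{h}_w:E\to\mathbb{R}$ by $\mathbf{h}_w(x)=\|x-w\|-\|o-w\|$. Equip $\mathbb{R}^E$ (all functions $E\to\mathbb{R}$) with the topology of pointwise convergence. $E^{\diamondsuit}$ is the closure of $\{\mathbf{h}_w : w\in E\}$ in $\mathbb{R}^E$. For a subset $X\subset E$, $X^{\diamondsuit}\subset E^{\diamondsuit}$ is the closure of $\{\mathbf{h}_w : w\in X\}$ in $\mathbb{R}^E$ (so its elements are functions on all of $E$). The elements of these sets are called metric functionals. *)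

theory Defs
  imports "HOL-Analysis.Analysis"
begin

definition nonexpansive :: "('a::real_normed_vector \<Rightarrow> 'a) \<Rightarrow> bool" where
  "nonexpansive T \<longleftrightarrow> 1-lipschitz_on UNIV T"

lemma nonexpansive_iff: "nonexpansive T \<longleftrightarrow> (\<forall>x y. norm (T x - T y) \<le> norm (x - y))"
  by (simp add: nonexpansive_def lipschitz_on_def dist_norm)

definition affine_mapping :: "('a::real_vector \<Rightarrow> 'a) \<Rightarrow> bool" where
  "affine_mapping T \<longleftrightarrow>
    (\<forall>x y t. 0 \<le> t \<and> t \<le> 1 \<longrightarrow>
      T ((1 - t) *\<^sub>R x + t *\<^sub>R y) = (1 - t) *\<^sub>R T x + t *\<^sub>R T y)"

definition commuting_family :: "('a \<Rightarrow> 'a) set \<Rightarrow> bool" where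
  "commuting_family F \<longleftrightarrow> (\<forall>T\<in>F. \<forall>U\<in>F. T \<circ> U = U \<circ> T)"

definition min_displacement :: "('a::real_normed_vector \<Rightarrow> 'a) \<Rightarrow> 'a set \<Rightarrow> real" where
  "min_displacement T X = (INF x\<in>X. norm (x - T x))"

definition internal_functional :: "'a::real_normed_vector \<Rightarrow> 'a \<Rightarrow> 'a \<Rightarrow> real" where
  "internal_functional b w = (\<lambda>x. norm (x - w) - norm (b - w))"

(* The topology on the function type 'a => real is the product topology
   (class instance from Function_Topology), that is, pointwise convergence.
   The base point is b. *)
definition metric_functionals :: "'a::real_normed_vector \<Rightarrow> 'a set \<Rightarrow> ('a \<Rightarrow> real) set" where
  "metric_functionals b X = closure (internal_functional b ` X)"

end

theory Submission
  imports Defs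
begin

text \<open>
  The functional is a limit of the functionals \<open>\<lambda>x. norm (x - w) - norm (b - w)\<close>
  along points \<open>w\<close> of \<open>X\<close> that are moved less and less by more and more members of \<open>F\<close>.
  If \<open>T\<close> is nonexpansive and moves \<open>w\<close> by at most \<open>\<epsilon>\<close>, then the functional of \<open>w\<close>
  satisfies \<open>h (T x) \<le> h x + \<epsilon>\<close> for every \<open>x\<close>. All functionals based at \<open>b\<close> lie in the compact
  box of functions with \<open>\<bar>h x\<bar> \<le> norm (x - b)\<close>, and each condition \<open>h (T x) \<le> h x + \<epsilon>\<close> is
  closed for pointwise convergence. By the finite intersection property the theorem reduces to
  showing that finitely many members of \<open>F\<close> have common approximate fixed points in \<open>X\<close>
  (\<open>common_approximate_fixed_point\<close>).

  Such points come from ergodic averages. Let \<open>A\<^sub>n w\<close> be the mean of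
  \<open>w, T w, \<dots>, T\<^sup>n\<^sup>-\<^sup>1 w\<close>. Because \<open>T\<close> is affine, \<open>T (A\<^sub>n w) - A\<^sub>n w\<close> telescopes to
  \<open>(T\<^sup>n w - w) / n\<close>, and this tends to \<open>0\<close>, since an orbit of a nonexpansive map with
  arbitrarily small displacements grows sublinearly. If \<open>U\<close> is affine and commutes with \<open>T\<close>,
  then \<open>U\<close> commutes with \<open>A\<^sub>n\<close>; as \<open>A\<^sub>n\<close> is nonexpansive, \<open>U\<close> moves \<open>A\<^sub>n w\<close> no more than it moves
  \<open>w\<close>. So averaging over \<open>T\<close> makes \<open>T\<close> almost fix the point without spoiling what was
  achieved for the other maps, and the finite case follows by adding one map at a time.
\<close>

section \<open>Ergodic averages of affine nonexpansive maps\<close>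

definition ergodic_average :: "('a::real_vector \<Rightarrow> 'a) \<Rightarrow> nat \<Rightarrow> 'a \<Rightarrow> 'a" where
  "ergodic_average T n x = (1 / real n) *\<^sub>R (\<Sum>j<n. (T ^^ j) x)"

lemma affine_mapping_mean:
  assumes "affine_mapping T" "n > 0"
  shows "T ((1 / real n) *\<^sub>R (\<Sum>j<n. f j)) = (1 / real n) *\<^sub>R (\<Sum>j<n. T (f j))"
  using \<open>n > 0\<close>
proof (induction n rule: nat_induct_non_zero)
  case 1
  then show ?case by simp
next
  case (Suc n)
  define t where "t = 1 / real (Suc n)"
  have t: "0 \<le> t" "t \<le> 1" by (auto simp: t_def)
  have weight: "(1 - t) * (1 / real n) = t"
    using Suc.hyps by (simp add: t_def field_simps)
  have split: "t *\<^sub>R (\<Sum>j<Suc n. g j) = (1 - t) *\<^sub>R ((1 / real n) *\<^sub>R (\<Sum>j<n. g j)) + t *\<^sub>R g n"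
    for g :: "nat \<Rightarrow> 'a"
    unfolding scaleR_scaleR weight by (simp add: scaleR_add_right)
  have "T (t *\<^sub>R (\<Sum>j<Suc n. f j))
      = (1 - t) *\<^sub>R T ((1 / real n) *\<^sub>R (\<Sum>j<n. f j)) + t *\<^sub>R T (f n)"
    unfolding split using assms(1) t unfolding affine_mapping_def by blast
  also have "\<dots> = t *\<^sub>R (\<Sum>j<Suc n. T (f j))"
    unfolding split Suc.IH ..
  finally show ?case by (simp only: t_def)
qed

lemma ergodic_average_displacement:
  assumes "affine_mapping T" "n > 0"
  shows "T (ergodic_average T n x) - ergodic_average T n x = (1 / real n) *\<^sub>R ((T ^^ n) x - x)"
proof -
  have "(\<Sum>j<n. (T ^^ Suc j) x) - (\<Sum>j<n. (T ^^ j) x) = (T ^^ n) x - x"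
    using sum_lessThan_telescope[of "\<lambda>j. (T ^^ j) x" n] by (simp add: sum_subtractf)
  then show ?thesis
    unfolding ergodic_average_def affine_mapping_mean[OF assms]
    by (simp flip: scaleR_diff_right)
qed

lemma ergodic_average_commute:
  assumes "affine_mapping U" "U \<circ> T = T \<circ> U" "n > 0"
  shows "U (ergodic_average T n x) = ergodic_average T n (U x)"
proof -
  have "U ((T ^^ j) x) = (T ^^ j) (U x)" for j
    using assms(2) by (induction j) (auto simp: fun_eq_iff)
  then show ?thesis
    unfolding ergodic_average_def affine_mapping_mean[OF assms(1,3)] by simp
qed

lemma ergodic_average_in:
  assumes "convex X" "T ` X \<subseteq> X" "x \<in> X" "n > 0"
  shows "ergodic_average T n x \<in> X"
proof -
  have "(T ^^ j) x \<in> X" for j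
    using assms by (induction j) auto
  then have "(\<Sum>j<n. (1 / real n) *\<^sub>R (T ^^ j) x) \<in> X"
    using assms by (intro convex_sum) auto
  then show ?thesis
    by (simp add: ergodic_average_def scaleR_sum_right)
qed

lemma nonexpansive_funpow:
  assumes "nonexpansive T"
  shows "norm ((T ^^ n) x - (T ^^ n) y) \<le> norm (x - y)"
proof (induction n)
  case (Suc n)
  have "norm (T ((T ^^ n) x) - T ((T ^^ n) y)) \<le> norm ((T ^^ n) x - (T ^^ n) y)"
    using assms by (simp add: nonexpansive_iff)
  with Suc show ?case by simp
qed simp

lemma norm_ergodic_average_diff_le:
  assumes "nonexpansive T" "n > 0"
  shows "norm (ergodic_average T n x - ergodic_average T n y) \<le> norm (x - y)"
proof -
  have "norm (\<Sum>j<n. (T ^^ j) x - (T ^^ j) y) \<le> real (card {..<n}) * norm (x - y)"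
    using nonexpansive_funpow[OF assms(1)] by (intro sum_norm_bound)
  then have "norm ((1 / real n) *\<^sub>R (\<Sum>j<n. (T ^^ j) x - (T ^^ j) y)) \<le> norm (x - y)"
    using assms(2) by (simp add: field_simps)
  then show ?thesis
    by (simp add: ergodic_average_def sum_subtractf scaleR_diff_right)
qed

lemma nonexpansive_orbit_bound:
  assumes "nonexpansive T"
  shows "norm ((T ^^ n) y - y) \<le> real n * norm (T y - y)"
proof (induction n)
  case (Suc n)
  have "norm ((T ^^ Suc n) y - y) \<le> norm ((T ^^ n) (T y) - (T ^^ n) y) + norm ((T ^^ n) y - y)"
    using norm_triangle_ineq[of "(T ^^ n) (T y) - (T ^^ n) y" "(T ^^ n) y - y"]
    by (simp add: funpow_swap1)
  also have "\<dots> \<le> norm (T y - y) + real n * norm (T y - y)"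
    using nonexpansive_funpow[OF assms, of n "T y" y] Suc by simp
  finally show ?case by (simp add: algebra_simps)
qed simp

section \<open>Common approximate fixed points\<close>

lemma min_displacement_zeroD:
  assumes "min_displacement T X = 0" "X \<noteq> {}" "\<epsilon> > 0"
  obtains y where "y \<in> X" "norm (T y - y) < \<epsilon>"
proof -
  have "bdd_below ((\<lambda>x. norm (x - T x)) ` X)"
    by (intro bdd_belowI[of _ 0]) auto
  then show ?thesis
    using assms that cINF_less_iff[of X "\<lambda>x. norm (x - T x)" \<epsilon>]
    by (auto simp: min_displacement_def norm_minus_commute)
qed

text \<open>
  Comparing the orbit of \<open>x\<close> with that of an almost fixed point \<open>y\<close> bounds
  \<open>norm ((T ^^ n) x - x)\<close> by \<open>2 * norm (x - y)\<close>, which does not depend on \<open>n\<close>, plus the small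
  linear drift of the orbit of \<open>y\<close>. After division by \<open>n\<close> only the drift survives, so the
  averages of every starting point, not only of a good one, become almost fixed.
\<close>

lemma ergodic_average_almost_fixed:
  assumes "affine_mapping T" "nonexpansive T" "min_displacement T X = 0" "X \<noteq> {}" "\<epsilon> > 0"
  obtains n where "n > 0" "norm (T (ergodic_average T n x) - ergodic_average T n x) \<le> \<epsilon>"
proof -
  obtain y where y: "norm (T y - y) < \<epsilon> / 2"
    using min_displacement_zeroD[OF assms(3,4), of "\<epsilon> / 2"] assms(5) by auto
  obtain n where n: "real n > 4 * norm (x - y) / \<epsilon>"
    using reals_Archimedean2 by blast
  have "0 \<le> 4 * norm (x - y) / \<epsilon>" using assms(5) by simp
  with n have pos: "n > 0" by (cases n) auto
  have "norm ((T ^^ n) x - x)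
      = norm (((T ^^ n) x - (T ^^ n) y) + ((T ^^ n) y - y) + (y - x))" by simp
  also have "\<dots> \<le> norm ((T ^^ n) x - (T ^^ n) y) + norm ((T ^^ n) y - y) + norm (y - x)"
    by (meson norm_triangle_ineq add_right_mono order_trans)
  also have "\<dots> \<le> norm (x - y) + real n * norm (T y - y) + norm (x - y)"
    using nonexpansive_funpow[OF assms(2), of n x y] nonexpansive_orbit_bound[OF assms(2), of n y]
    by (simp add: norm_minus_commute)
  also have "\<dots> \<le> real n * \<epsilon>"
  proof -
    have "real n * norm (T y - y) \<le> real n * (\<epsilon> / 2)"
      using y by (intro mult_left_mono) auto
    moreover have "4 * norm (x - y) < real n * \<epsilon>"
      using n assms(5) by (simp add: field_simps)
    ultimately show ?thesis by simp
  qed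
  finally have "norm ((1 / real n) *\<^sub>R ((T ^^ n) x - x)) \<le> \<epsilon>"
    using pos by (simp add: pos_divide_le_eq mult.commute del: scaleR_diff_right)
  then show ?thesis
    using that[OF pos] ergodic_average_displacement[OF assms(1) pos, of x] by simp
qed

lemma common_approximate_fixed_point:
  assumes "finite G" "commuting_family G"
    and "\<And>T. T \<in> G \<Longrightarrow> affine_mapping T"
    and "\<And>T. T \<in> G \<Longrightarrow> nonexpansive T"
    and "X \<noteq> {}" "convex X"
    and "\<And>T. T \<in> G \<Longrightarrow> T ` X \<subseteq> X"
    and "\<And>T. T \<in> G \<Longrightarrow> min_displacement T X = 0"
    and "\<epsilon> > 0"
  shows "\<exists>w\<in>X. \<forall>T\<in>G. norm (T w - w) \<le> \<epsilon>"
  using assms(1-4,7,8)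
proof (induction G)
  case empty
  then show ?case using assms(5) by auto
next
  case (insert T G)
  have "commuting_family G"
    using insert.prems(1) by (simp add: commuting_family_def)
  then obtain w where w: "w \<in> X" "\<forall>U\<in>G. norm (U w - w) \<le> \<epsilon>"
    using insert.IH insert.prems by auto
  obtain n where n: "n > 0" "norm (T (ergodic_average T n w) - ergodic_average T n w) \<le> \<epsilon>"
    using ergodic_average_almost_fixed[of T X \<epsilon> w] insert.prems assms(5,9) by auto
  have "norm (U (ergodic_average T n w) - ergodic_average T n w) \<le> \<epsilon>" if "U \<in> G" for U
  proof -
    have "U (ergodic_average T n w) = ergodic_average T n (U w)"
    proof (rule ergodic_average_commute)
      show "affine_mapping U" using insert.prems(2) that by blast
      show "U \<circ> T = T \<circ> U"
        using insert.prems(1) that unfolding commuting_family_def by blast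
    qed (fact n(1))
    then have "norm (U (ergodic_average T n w) - ergodic_average T n w) \<le> norm (U w - w)"
      using norm_ergodic_average_diff_le[of T n "U w" w] insert.prems n(1) by simp
    also have "\<dots> \<le> \<epsilon>" using w(2) that by blast
    finally show ?thesis .
  qed
  moreover have "ergodic_average T n w \<in> X"
    using insert.prems assms(6) w(1) n(1) by (intro ergodic_average_in) auto
  ultimately show ?case using n(2) by auto
qed

section \<open>Compactness of the space of metric functionals\<close>

lemma internal_functional_abs_le: "\<bar>internal_functional b w x\<bar> \<le> norm (x - b)"
  using norm_triangle_ineq3[of "x - w" "b - w"] by (simp add: internal_functional_def)

lemma compact_metric_functionals: "compact (metric_functionals b X)"
proof -
  define K where "K = (\<Pi>\<^sub>E x\<in>UNIV. cball (0::real) (norm (x - b)))"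
  have "compactin (product_topology (\<lambda>_. euclidean) UNIV) K"
    unfolding K_def by (simp add: compactin_PiE)
  then have K: "compact K"
    by (simp add: euclidean_product_topology)
  have "K = {h. \<forall>x. \<bar>h x\<bar> \<le> norm (x - b)}"
    by (auto simp: K_def PiE_UNIV_domain dist_real_def)
  moreover have "closed {h. \<forall>x. \<bar>h x\<bar> \<le> norm (x - b)}"
    by (intro closed_Collect_all closed_Collect_le continuous_intros
        continuous_on_product_coordinates)
  ultimately have "closure (internal_functional b ` X) \<subseteq> K"
    using internal_functional_abs_le by (intro closure_minimal) auto
  then show ?thesis
    using compact_Int_closed[OF K, of "closure (internal_functional b ` X)"]
    by (simp add: metric_functionals_def Int_absorb1)
qed

lemma closed_almost_decreasing:
  fixes T :: "'a \<Rightarrow> 'a"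
  shows "closed {h :: 'a \<Rightarrow> real. \<forall>x. h (T x) \<le> h x + \<epsilon>}"
  by (intro closed_Collect_all closed_Collect_le continuous_intros
      continuous_on_product_coordinates)

lemma internal_functional_almost_decreasing:
  assumes "nonexpansive T" "norm (T w - w) \<le> \<epsilon>"
  shows "internal_functional b w (T x) \<le> internal_functional b w x + \<epsilon>"
proof -
  have "norm (T x - w) \<le> norm (T x - T w) + norm (T w - w)"
    using norm_triangle_ineq[of "T x - T w" "T w - w"] by simp
  also have "\<dots> \<le> norm (x - w) + \<epsilon>"
    using assms by (auto simp: nonexpansive_iff intro: add_mono)
  finally show ?thesis by (simp add: internal_functional_def)
qed

section \<open>The common decreasing metric functional\<close>

theorem theorem3p1:
  fixes b :: "'a::banach" and F :: "('a \<Rightarrow> 'a) set" and X :: "'a set"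
  assumes "commuting_family F"
    and "\<And>T. T \<in> F \<Longrightarrow> affine_mapping T"
    and "\<And>T. T \<in> F \<Longrightarrow> nonexpansive T"
    and "X \<noteq> {}" and "convex X"
    and "\<And>T. T \<in> F \<Longrightarrow> T ` X \<subseteq> X"
    and "\<And>T. T \<in> F \<Longrightarrow> min_displacement T X = 0"
  shows "\<exists>h\<in>metric_functionals b X. \<forall>T\<in>F. \<forall>x. h (T x) \<le> h x"
proof -
  define C where "C = (\<lambda>(T, \<epsilon>). {h :: 'a \<Rightarrow> real. \<forall>x. h (T x) \<le> h x + \<epsilon>})"
  have "metric_functionals b X \<inter> (\<Inter>p \<in> F \<times> {0<..}. C p) \<noteq> {}"
  proof (rule compact_imp_fip_image[OF compact_metric_functionals])
    show "closed (C p)" if "p \<in> F \<times> {0<..}" for p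
      by (auto simp: C_def split: prod.split intro: closed_almost_decreasing)
  next
    fix Q assume Q: "finite Q" "Q \<subseteq> F \<times> {0::real<..}"
    \<comment> \<open>The extra \<open>1\<close> makes the minimum meaningful when \<open>Q\<close> is empty.\<close>
    define \<epsilon> where "\<epsilon> = Min (insert 1 (snd ` Q))"
    have "\<epsilon> > 0"
      unfolding \<epsilon>_def using Q by (subst Min_gr_iff) auto
    have le: "\<epsilon> \<le> snd p" if "p \<in> Q" for p
      unfolding \<epsilon>_def using Q(1) that by (intro Min_le) auto
    have sub: "fst ` Q \<subseteq> F" using Q(2) by auto
    have "\<exists>w\<in>X. \<forall>T\<in>fst ` Q. norm (T w - w) \<le> \<epsilon>"
    proof (rule common_approximate_fixed_point)
      show "commuting_family (fst ` Q)"
        using assms(1) sub unfolding commuting_family_def by blast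
    qed (use assms(2-7) sub finite_imageI[OF Q(1)] \<open>\<epsilon> > 0\<close> in blast)+
    then obtain w where w: "w \<in> X" "\<And>p. p \<in> Q \<Longrightarrow> norm (fst p w - w) \<le> \<epsilon>" by auto
    have "internal_functional b w \<in> C p" if "p \<in> Q" for p
    proof -
      have "norm (fst p w - w) \<le> snd p" "nonexpansive (fst p)"
        using w(2)[OF that] le[OF that] assms(3) sub that by auto
      then show ?thesis
        by (auto simp: C_def split_beta intro: internal_functional_almost_decreasing)
    qed
    moreover have "internal_functional b w \<in> metric_functionals b X"
      unfolding metric_functionals_def using w(1) by (intro subsetD[OF closure_subset] imageI)
    ultimately show "metric_functionals b X \<inter> (\<Inter>p\<in>Q. C p) \<noteq> {}" by blast
  qed
  then obtain h where h: "h \<in> metric_functionals b X"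
    "\<And>T \<epsilon> x. T \<in> F \<Longrightarrow> \<epsilon> > 0 \<Longrightarrow> h (T x) \<le> h x + \<epsilon>"
    unfolding C_def by fastforce
  have "h (T x) \<le> h x" if "T \<in> F" for T x
    using h(2)[OF that] by (rule field_le_epsilon)
  with h(1) show ?thesis by blast
qed

end
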